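(* Let $\kappa>1$. The function $\epsilon\mapsto N_\epsilon$ is constant on each half-open interval $[\epsilon_i,\epsilon_{i-1})$, $i\ge1$; these constant values are distinct and strictly increasing in $i$. Moreover, for each $i\ge1$, $N_{\epsilon_i}$ is also $\kappa$-colossally abundant for $\epsilon_{i+1}$.
   Context: For real $\kappa>0$ and a positive integer $n$, $\sigma^{[\kappa]}(n):=\sum_{d\mid n}\mu(n/d)\sigma(d)^{\kappa}$ ($\sigma$ the sum-of-divisors function, $\mu$ the Möbius function). For $\epsilon>0$, a positive integer $N$ is $\kappa$-colossally abundant for $\epsilon$ if $\sigma^{[\kappa]}(N)/N^{\kappa(1+\epsilon)}\ge\sigma^{[\kappa]}(n)/n^{\kappa(1+\epsilon)}$ for all positive integers $n$; $N_\epsilon$ denotes the largest such $N$. For $x>1$, $a\ge1$, $F^{[\kappa]}(x,a):=\frac{1}{\kappa\log x}\log\left(\frac{(x^{a+1}-1)^{\kappa}-(x^{a}-1)^{\kappa}}{(x^{a+1}-x)^{\kappa}-(x^{a}-x)^{\kappa}}\right)$. Let $E:=\{F^{[\kappa]}(p,j): p\text{ prime},\ j\in\mathbb{Z}_{>0}\}\cup\{\infty\}$, enumerated as $\infty=\epsilon_0>\epsilon_1>\epsilon_2>\cdots>0$ with $\epsilon_i\to0$.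
   Formalization: The intervals are taken as (ε_i, ε_{i−1}] (for i=1: all reals above ε_1) instead of [ε_i, ε_{i−1}); with N_ε the largest such number the printed intervals fail, e.g. κ=2, ε_1=1/2: N_{1/2}=2 but N_ε=1 for ε>1/2. *)

theory Defs
  imports "HOL-Analysis.Analysis" "HOL-Computational_Algebra.Computational_Algebra"
begin

definition divisor_sum :: "nat \<Rightarrow> nat" where
  "divisor_sum n = (\<Sum>d | d dvd n. d)"

definition moebius_mu :: "nat \<Rightarrow> int" where
  "moebius_mu n = (if squarefree n then (-1) ^ card (prime_factors n) else 0)"

definition sigma_kappa :: "real \<Rightarrow> nat \<Rightarrow> real" where
  "sigma_kappa \<kappa> n =
     (\<Sum>d | d dvd n. of_int (moebius_mu (n div d)) * real (divisor_sum d) powr \<kappa>)"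

definition colossally_abundant :: "real \<Rightarrow> real \<Rightarrow> nat \<Rightarrow> bool" where
  "colossally_abundant \<kappa> \<epsilon> N \<longleftrightarrow>
     N > 0 \<and>
     (\<forall>n>0. sigma_kappa \<kappa> N / real N powr (\<kappa> * (1 + \<epsilon>))
              \<ge> sigma_kappa \<kappa> n / real n powr (\<kappa> * (1 + \<epsilon>)))"

text \<open>
  \<open>GREATEST\<close> is unspecified when there is no largest element; the theorem therefore also
  asserts that a largest colossally abundant number exists.
\<close>
definition largest_CA :: "real \<Rightarrow> real \<Rightarrow> nat" where
  "largest_CA \<kappa> \<epsilon> = (GREATEST N. colossally_abundant \<kappa> \<epsilon> N)"

definition F_kappa :: "real \<Rightarrow> real \<Rightarrow> real \<Rightarrow> real" where
  "F_kappa \<kappa> x a =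
     1 / (\<kappa> * ln x) *
     ln (((x powr (a + 1) - 1) powr \<kappa> - (x powr a - 1) powr \<kappa>) /
         ((x powr (a + 1) - x) powr \<kappa> - (x powr a - x) powr \<kappa>))"

definition critical_set :: "real \<Rightarrow> ereal set" where
  "critical_set \<kappa> =
     {ereal (F_kappa \<kappa> (real p) (real j)) | p j :: nat. prime p \<and> j > 0} \<union> {\<infinity>}"

definition critical_enumeration :: "real \<Rightarrow> (nat \<Rightarrow> ereal) \<Rightarrow> bool" where
  "critical_enumeration \<kappa> e \<longleftrightarrow>
     e 0 = \<infinity> \<and> (\<forall>i. e (Suc i) < e i) \<and> (\<forall>i. e i > 0) \<and>
     range e = critical_set \<kappa> \<and> e \<longlonglongrightarrow> 0"

text \<open>
  The half-open interval between two consecutive critical values is closed at its larger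
  endpoint. This is the orientation that goes with taking the \<^emph>\<open>largest\<close> colossally abundant
  number: at a critical value \<open>e i\<close> several numbers are colossally abundant, and the largest of
  them is the one that stays colossally abundant when \<open>\<epsilon>\<close> decreases below \<open>e i\<close>.
  For \<open>i = 1\<close> the larger endpoint is \<open>\<infinity>\<close>, and the interval consists of all reals above \<open>e 1\<close>.
\<close>
definition critical_interval :: "(nat \<Rightarrow> ereal) \<Rightarrow> nat \<Rightarrow> real set" where
  "critical_interval e i = {\<epsilon>. e i < ereal \<epsilon> \<and> ereal \<epsilon> \<le> e (i - 1)}"

end

theory Submission
  imports Defs
begin

text \<open>
  By Cauchy's mean value theorem, \<open>F_kappa \<kappa> x a\<close> equals
  \<open>(\<kappa> - 1) / (\<kappa> ln x) \<sqdot> ln ((c - 1) / (c - x))\<close> for some \<open>c\<close> strictly between \<open>x\<^sup>a\<close> and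
  \<open>x\<^bsup>a + 1\<^esup>\<close>. Since \<open>(c - 1) / (c - x)\<close> exceeds 1 and decreases in \<open>c\<close>, the critical values are
  positive and, for each prime, strictly decreasing in the exponent; a quantitative version shows
  that only finitely many of them exceed any given positive bound.

  As \<open>sigma_kappa\<close> is multiplicative, multiplying \<open>n\<close> by a prime \<open>p\<close> with \<open>p\<^bsup>j - 1\<^esup>\<close> exactly
  dividing \<open>n\<close> multiplies the quotient to be maximised by \<open>p\<close> to the power
  \<open>\<kappa> (F_kappa \<kappa> p j - \<epsilon>)\<close>. Hence the largest colossally abundant number for \<open>\<epsilon>\<close> is the product of
  \<open>p\<close> over all pairs \<open>(p, j)\<close> with \<open>F_kappa \<kappa> p j \<ge> \<epsilon>\<close>, and it changes exactly when \<open>\<epsilon>\<close> passes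
  a critical value.
\<close>

section \<open>The critical values\<close>

text \<open>Cauchy's mean value theorem for \<open>(t - 1) powr \<kappa>\<close> and
  \<open>(t - x) powr \<kappa>\<close> between \<open>x powr a\<close> and
  \<open>x powr (a + 1)\<close>; the quotient of the derivatives is the displayed power.\<close>

lemma F_kappa_mean_value:
  fixes \<kappa> x a :: real
  assumes \<kappa>: "\<kappa> > 1" and x: "x > 1" and a: "a \<ge> 1"
  obtains c where "x powr a < c" "c < x powr (a + 1)"
    "(x powr (a + 1) - 1) powr \<kappa> - (x powr a - 1) powr \<kappa> =
       ((c - 1) / (c - x)) powr (\<kappa> - 1) * ((x powr (a + 1) - x) powr \<kappa> - (x powr a - x) powr \<kappa>)"
proof -
  define u v where "u = x powr a" and "v = x powr (a + 1)"
  have uv: "x \<le> u" "u < v"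
    using powr_mono[of 1 a x] powr_less_mono[of a "a + 1" x] x a by (auto simp: u_def v_def)
  define f g where "f = (\<lambda>t. (t - 1) powr \<kappa>)" and "g = (\<lambda>t. (t - x) powr \<kappa>)"
  \<comment> \<open>The usual auxiliary function of Cauchy's theorem: it takes equal values at
    \<open>u\<close> and \<open>v\<close>, so Rolle's theorem applies.\<close>
  define \<phi> where "\<phi> = (\<lambda>t. (f v - f u) * g t - (g v - g u) * f t)"
  have deriv: "(\<phi> has_real_derivative
      (f v - f u) * (\<kappa> * (t - x) powr (\<kappa> - 1)) - (g v - g u) * (\<kappa> * (t - 1) powr (\<kappa> - 1))) (at t)"
    if "u < t" for t
    unfolding \<phi>_def f_def g_def using that uv x
    by (auto intro!: derivative_eq_intros)
  \<comment> \<open>For \<open>a = 1\<close> the left endpoint is \<open>x\<close>, where the base of \<open>g\<close> vanishes; the library's \<open>GMVT\<close>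
      would require two-sided continuity there.\<close>
  have "\<exists>c. u < c \<and> c < v \<and> DERIV \<phi> c :> 0"
  proof (rule Rolle)
    show "continuous_on {u..v} \<phi>"
      unfolding \<phi>_def f_def g_def using uv x \<kappa>
      by (intro continuous_intros continuous_on_powr') auto
    show "\<phi> differentiable (at t)" if "u < t" for t
      using deriv[OF that] real_differentiable_def by blast
  qed (use uv in \<open>auto simp: \<phi>_def algebra_simps\<close>)
  then obtain c where c: "u < c" "c < v" "DERIV \<phi> c :> 0" by blast
  have "(f v - f u) * (\<kappa> * (c - x) powr (\<kappa> - 1)) = (g v - g u) * (\<kappa> * (c - 1) powr (\<kappa> - 1))"
    using DERIV_unique[OF deriv[OF c(1)] c(3)] by simp
  hence "(f v - f u) * (c - x) powr (\<kappa> - 1) = (g v - g u) * (c - 1) powr (\<kappa> - 1)"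
    using \<kappa> by simp
  hence "f v - f u = ((c - 1) / (c - x)) powr (\<kappa> - 1) * (g v - g u)"
    using c uv x by (simp add: powr_divide field_simps)
  thus ?thesis using that c unfolding f_def g_def u_def v_def by blast
qed

text \<open>Strict monotonicity of the power makes the denominator in \<open>F_kappa\<close>
  positive. Dividing the mean value identity by it leaves a pure power, whose exponent
  \<open>\<kappa> - 1\<close> comes out of the logarithm.\<close>

lemma F_kappa_eq_ln:
  fixes \<kappa> x a :: real
  assumes \<kappa>: "\<kappa> > 1" and x: "x > 1" and a: "a \<ge> 1"
  obtains c where "x powr a < c" "c < x powr (a + 1)" "x < c"
    "F_kappa \<kappa> x a = (\<kappa> - 1) / (\<kappa> * ln x) * ln ((c - 1) / (c - x))"
proof -
  obtain c where c: "x powr a < c" "c < x powr (a + 1)"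
    "(x powr (a + 1) - 1) powr \<kappa> - (x powr a - 1) powr \<kappa> =
       ((c - 1) / (c - x)) powr (\<kappa> - 1) * ((x powr (a + 1) - x) powr \<kappa> - (x powr a - x) powr \<kappa>)"
    using F_kappa_mean_value[OF assms] .
  have u: "x \<le> x powr a" using powr_mono[of 1 a x] x a by simp
  have "(x powr a - x) powr \<kappa> < (x powr (a + 1) - x) powr \<kappa>"
    using u c(1,2) \<kappa> by (intro powr_less_mono2) auto
  hence "F_kappa \<kappa> x a = (\<kappa> - 1) / (\<kappa> * ln x) * ln ((c - 1) / (c - x))"
    unfolding F_kappa_def c(3) using c u x by (simp add: ln_powr)
  thus ?thesis using that c u by force
qed

lemma F_kappa_pos:
  assumes "\<kappa> > 1" "x > 1" "a \<ge> 1"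
  shows "F_kappa \<kappa> x a > 0"
proof -
  obtain c where c: "x < c" "F_kappa \<kappa> x a = (\<kappa> - 1) / (\<kappa> * ln x) * ln ((c - 1) / (c - x))"
    using F_kappa_eq_ln[OF assms] by metis
  have "ln ((c - 1) / (c - x)) > 0" using c(1) assms by (intro ln_gt_zero) (simp add: field_simps)
  thus ?thesis using c(2) assms by simp
qed

text \<open>A gap of at least 1 between the exponents keeps the two mean value points apart:
  \<open>c < x powr (a + 1) \<le> x powr b < d\<close>. This covers all pairs of distinct positive
  integers.\<close>

lemma F_kappa_strict_antimono:
  assumes "\<kappa> > 1" "x > 1" "a \<ge> 1" "a + 1 \<le> b"
  shows "F_kappa \<kappa> x b < F_kappa \<kappa> x a"
proof -
  obtain c where c: "x < c" "c < x powr (a + 1)"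
      "F_kappa \<kappa> x a = (\<kappa> - 1) / (\<kappa> * ln x) * ln ((c - 1) / (c - x))"
    using F_kappa_eq_ln[of \<kappa> x a] assms by metis
  obtain d where d: "x powr b < d"
      "F_kappa \<kappa> x b = (\<kappa> - 1) / (\<kappa> * ln x) * ln ((d - 1) / (d - x))"
    using F_kappa_eq_ln[of \<kappa> x b] assms by auto
  have "x powr (a + 1) \<le> x powr b" using assms by (intro powr_mono) auto
  hence cd: "c < d" using c d by linarith
  have "(d - 1) * (c - x) < (c - 1) * (d - x)"
    using mult_strict_left_mono[OF cd, of "x - 1"] assms(2) by (simp add: algebra_simps)
  hence "(d - 1) / (d - x) < (c - 1) / (c - x)"
    using cd c(1) by (simp add: divide_simps)
  hence "ln ((d - 1) / (d - x)) < ln ((c - 1) / (c - x))"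
    using cd c(1) assms by (intro ln_less_cancel_iff[THEN iffD2]) auto
  thus ?thesis unfolding c(3) d(2) using assms by (intro mult_strict_left_mono) auto
qed

section \<open>Upper bounds, and finiteness of the critical values above a positive bound\<close>

lemma F_kappa_bound_ge_2:
  assumes "\<kappa> > 1" "x > 1" "a \<ge> 2"
  shows "F_kappa \<kappa> x a \<le> 1 / (ln x * x powr (a / 2))"
proof -
  obtain c where c: "x powr a < c" "x < c"
      "F_kappa \<kappa> x a = (\<kappa> - 1) / (\<kappa> * ln x) * ln ((c - 1) / (c - x))"
    using F_kappa_eq_ln[of \<kappa> x a] assms by auto
  define y where "y = x powr (a / 2)"
  have y: "y \<ge> x" "y\<^sup>2 = x powr a"
    using powr_mono[of 1 "a/2" x] assms by (auto simp: y_def power2_eq_square simp flip: powr_add)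
  \<comment> \<open>Expanding this product bounds \<open>c - x\<close> below by
    \<open>(x - 1) * y\<close>; \<open>a \<ge> 2\<close> enters through \<open>y \<ge> x\<close>.
    With \<open>ln (1 + t) \<le> t\<close> the factor \<open>x - 1\<close> then cancels.\<close>
  have "0 \<le> (y - x) * (y + 1)" using y assms by (intro mult_nonneg_nonneg) auto
  hence "(x - 1) * y \<le> y\<^sup>2 - x" by (simp add: algebra_simps power2_eq_square)
  hence "(x - 1) * y \<le> c - x" using y c by linarith
  moreover have "(c - 1) / (c - x) = 1 + (x - 1) / (c - x)" using c(2) by (simp add: field_simps)
  hence "ln ((c - 1) / (c - x)) \<le> (x - 1) / (c - x)"
    using ln_add_one_self_le_self[of "(x - 1) / (c - x)"] c assms by simp
  moreover have "(x - 1) / (c - x) \<le> 1 / y" if "(x - 1) * y \<le> c - x"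
    using that y c assms by (simp add: divide_simps mult.commute)
  ultimately have "ln ((c - 1) / (c - x)) \<le> 1 / y" by linarith
  hence "F_kappa \<kappa> x a \<le> (\<kappa> - 1) / (\<kappa> * ln x) * (1 / y)"
    unfolding c(3) using assms by (intro mult_left_mono) auto
  also have "\<dots> = (\<kappa> - 1) / \<kappa> * (1 / (ln x * y))" by simp
  also have "\<dots> \<le> 1 * (1 / (ln x * y))"
    using assms y by (intro mult_right_mono) auto
  finally show ?thesis by (simp add: y_def)
qed

text \<open>For \<open>a = 1\<close> the mean value point may lie close to \<open>x\<close>, where
  \<open>(c - 1) / (c - x)\<close> is unbounded, so the definition is estimated directly. The second
  power in the denominator is that of 0; dropping the subtracted power in the numerator leaves at
  most \<open>(1 + 1 / x) powr \<kappa>\<close>.\<close>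

lemma F_kappa_bound_1:
  assumes "\<kappa> > 1" "x > 1"
  shows "F_kappa \<kappa> x 1 \<le> 1 / (ln x * x)"
proof -
  have sq: "x powr (1 + 1) = x\<^sup>2" using assms by (simp add: powr_numeral)
  have lt: "x < x\<^sup>2" using assms by (simp add: power2_eq_square)
  have pos: "(x - 1) powr \<kappa> < (x\<^sup>2 - 1) powr \<kappa>"
    using assms lt by (intro powr_less_mono2) auto
  have "((x\<^sup>2 - 1) powr \<kappa> - (x - 1) powr \<kappa>) / (x\<^sup>2 - x) powr \<kappa> \<le> (x\<^sup>2 - 1) powr \<kappa> / (x\<^sup>2 - x) powr \<kappa>"
    by (intro divide_right_mono) auto
  also have "\<dots> = ((x\<^sup>2 - 1) / (x\<^sup>2 - x)) powr \<kappa>"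
    using lt assms by (simp add: powr_divide)
  also have "(x\<^sup>2 - 1) / (x\<^sup>2 - x) = 1 + 1 / x"
    using lt assms by (simp add: field_simps power2_eq_square)
  finally have "ln (((x\<^sup>2 - 1) powr \<kappa> - (x - 1) powr \<kappa>) / (x\<^sup>2 - x) powr \<kappa>) \<le> ln ((1 + 1 / x) powr \<kappa>)"
    using pos lt assms by (intro ln_mono) auto
  also have "\<dots> = \<kappa> * ln (1 + 1 / x)" using assms by (simp add: ln_powr add_pos_pos)
  also have "\<dots> \<le> \<kappa> * (1 / x)"
    using ln_add_one_self_le_self[of "1 / x"] assms by (intro mult_left_mono) auto
  finally have "F_kappa \<kappa> x 1 \<le> 1 / (\<kappa> * ln x) * (\<kappa> * (1 / x))"
    unfolding F_kappa_def sq using assms by (intro mult_left_mono) auto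
  thus ?thesis using assms by simp
qed

lemma F_kappa_bound:
  assumes "\<kappa> > 1" "x > 1" "j > 0"
  shows "F_kappa \<kappa> x (real j) \<le> 1 / (ln x * x powr (real j / 2))"
proof (cases "j = 1")
  case True
  have "F_kappa \<kappa> x 1 \<le> 1 / (ln x * x)" using F_kappa_bound_1 assms by auto
  also have "\<dots> \<le> 1 / (ln x * x powr (1 / 2))"
    using powr_mono[of "1/2" 1 x] assms
    by (intro divide_left_mono mult_left_mono mult_pos_pos) auto
  finally show ?thesis using True by simp
next
  case False
  thus ?thesis using F_kappa_bound_ge_2[of \<kappa> x "real j"] assms by simp
qed

text \<open>The bound on \<open>F_kappa\<close> together with \<open>ln p \<ge> ln 2\<close> bounds
  the square root of \<open>p ^ j\<close>, and both \<open>p\<close> and \<open>j\<close> are at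
  most \<open>p ^ j\<close>. The square in the choice of \<open>K\<close> undoes that root.\<close>

lemma finite_F_kappa_ge:
  assumes "\<kappa> > 1" "\<epsilon> > 0"
  shows "finite {(p, j). prime p \<and> j > 0 \<and> F_kappa \<kappa> (real p) (real j) \<ge> \<epsilon>}" (is "finite ?S")
proof -
  obtain K :: nat where K: "(1 / (ln 2 * \<epsilon>))\<^sup>2 \<le> real K" using real_arch_simple by blast
  have "p \<le> K \<and> j \<le> K" if "(p, j) \<in> ?S" for p j
  proof -
    have p: "real p \<ge> 2" and j: "j > 0" and F: "\<epsilon> \<le> F_kappa \<kappa> (real p) (real j)"
      using that prime_ge_2_nat by auto
    have "\<epsilon> \<le> 1 / (ln (real p) * real p powr (real j / 2))"
      using F_kappa_bound[of \<kappa> "real p" j] p j F assms by linarith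
    also have "\<dots> \<le> 1 / (ln 2 * real p powr (real j / 2))"
      using p by (intro divide_left_mono mult_right_mono mult_pos_pos) auto
    finally have "real p powr (real j / 2) \<le> 1 / (ln 2 * \<epsilon>)"
      using p assms by (simp add: field_simps)
    hence "(real p powr (real j / 2))\<^sup>2 \<le> real K"
      using K power_mono[of "real p powr (real j / 2)" _ 2] by (smt (verit) powr_ge_zero)
    also have "(real p powr (real j / 2))\<^sup>2 = real p powr real j"
      by (simp add: power2_eq_square flip: powr_add)
    also have "\<dots> = real (p ^ j)" using p by (simp add: powr_realpow)
    finally have le: "p ^ j \<le> K" by simp
    have "j < p ^ j" using p by (intro power_gt_expt) auto
    moreover have "p ^ 1 \<le> p ^ j" using p j by (intro power_increasing) auto
    ultimately show ?thesis using le by simp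
  qed
  hence "?S \<subseteq> {..K} \<times> {..K}" by auto
  thus ?thesis by (rule finite_subset) auto
qed

section \<open>Multiplicativity\<close>

lemma bij_betw_divisors_coprime:
  fixes a b :: nat
  assumes "coprime a b" "a > 0" "b > 0"
  shows "bij_betw (\<lambda>(x, y). x * y) ({d. d dvd a} \<times> {d. d dvd b}) {d. d dvd a * b}"
  unfolding bij_betw_def
proof
  show "inj_on (\<lambda>(x, y). x * y) ({d. d dvd a} \<times> {d. d dvd b})"
  proof (rule inj_onI, clarsimp)
    fix x y x' y' assume *: "x dvd a" "y dvd b" "x' dvd a" "y' dvd b" "x * y = x' * y'"
    have "coprime x y'" "coprime x' y"
      using coprime_divisors[OF _ _ assms(1)] * by blast+
    hence "x dvd x'" "x' dvd x"
      using *(5) by (metis coprime_dvd_mult_left_iff dvd_triv_left)+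
    hence "x = x'" by (rule dvd_antisym)
    moreover have "x > 0" using *(1) assms(2) by (rule dvd_pos_nat[rotated])
    ultimately show "x = x' \<and> y = y'" using *(5) by simp
  qed
  show "(\<lambda>(x, y). x * y) ` ({d. d dvd a} \<times> {d. d dvd b}) = {d. d dvd a * b}"
    (is "?l = ?r")
  proof
    show "?l \<subseteq> ?r" by (auto intro: mult_dvd_mono)
    show "?r \<subseteq> ?l"
    proof
      fix d assume "d \<in> ?r"
      then obtain x y where "d = x * y" "x dvd a" "y dvd b" using division_decomp by blast
      thus "d \<in> ?l" by (intro image_eqI[of _ _ "(x, y)"]) auto
    qed
  qed
qed

lemma div_dvd_self: "(d :: nat) dvd n \<Longrightarrow> n div d dvd n"
  by (metis dvd_div_mult_self dvd_triv_left)

lemma sum_divisors_coprime: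
  fixes a b :: nat and f :: "nat \<Rightarrow> 'a :: comm_monoid_add"
  assumes "coprime a b" "a > 0" "b > 0"
  shows "(\<Sum>d | d dvd a * b. f d) = (\<Sum>x | x dvd a. \<Sum>y | y dvd b. f (x * y))"
proof -
  have "(\<Sum>d | d dvd a * b. f d) = (\<Sum>(x, y)\<in>{d. d dvd a} \<times> {d. d dvd b}. f (x * y))"
    using sum.reindex_bij_betw[OF bij_betw_divisors_coprime[OF assms], of f]
    by (simp only: case_prod_unfold)
  thus ?thesis by (simp only: sum.cartesian_product)
qed

lemma divisor_sum_mult_coprime:
  assumes "coprime a b" "a > 0" "b > 0"
  shows "divisor_sum (a * b) = divisor_sum a * divisor_sum b"
  unfolding divisor_sum_def sum_divisors_coprime[OF assms] by (simp add: sum_product)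

lemma moebius_mu_mult_coprime:
  assumes "coprime a b" "a > 0" "b > 0"
  shows "moebius_mu (a * b) = moebius_mu a * moebius_mu b"
proof (cases "squarefree a \<and> squarefree b")
  case True
  have "prime_factors a \<inter> prime_factors b = {}"
    by (auto simp: in_prime_factors_iff) (meson assms(1) coprime_common_divisor not_prime_unit)
  hence "card (prime_factors (a * b)) = card (prime_factors a) + card (prime_factors b)"
    using assms by (simp add: prime_factors_product card_Un_disjoint)
  thus ?thesis using True squarefree_mult_coprime[OF assms(1)]
    by (simp add: moebius_mu_def power_add)
next
  case False
  hence "\<not> squarefree (a * b)" using squarefree_multD by blast
  thus ?thesis using False by (auto simp: moebius_mu_def)
qed

text \<open>A Dirichlet convolution of multiplicative functions is multiplicative: the divisors of
  \<open>a * b\<close> are the products \<open>x * y\<close>, and both the cofactors and the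
  divisors stay coprime, so each summand factors.\<close>

lemma sigma_kappa_mult_coprime:
  assumes "coprime a b" "a > 0" "b > 0"
  shows "sigma_kappa \<kappa> (a * b) = sigma_kappa \<kappa> a * sigma_kappa \<kappa> b"
proof -
  have "of_int (moebius_mu (a * b div (x * y))) * real (divisor_sum (x * y)) powr \<kappa> =
        (of_int (moebius_mu (a div x)) * real (divisor_sum x) powr \<kappa>) *
        (of_int (moebius_mu (b div y)) * real (divisor_sum y) powr \<kappa>)"
    if "x dvd a" "y dvd b" for x y
  proof -
    have "coprime x y" "coprime (a div x) (b div y)"
      using that coprime_divisors[OF _ _ assms(1)] by (blast intro: div_dvd_self)+
    moreover have "x > 0" "y > 0" "a div x > 0" "b div y > 0"
      using that assms by (auto simp: div_greater_zero_iff intro: dvd_pos_nat dvd_imp_le)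
    ultimately show ?thesis 
      unfolding div_mult_div_if_dvd[OF that, symmetric]
      by (simp add: moebius_mu_mult_coprime divisor_sum_mult_coprime powr_mult)
  qed
  thus ?thesis
    unfolding sigma_kappa_def sum_divisors_coprime[OF assms] by (simp add: sum_product)
qed

section \<open>Values at prime powers and the effect of one more prime factor\<close>

lemma divisor_sum_prime_power:
  assumes "prime p"
  shows "real (divisor_sum (p ^ k)) * (real p - 1) = real p ^ Suc k - 1"
proof -
  have "{d. d dvd p ^ k} = (\<lambda>i. p ^ i) ` {..k}"
    using divides_primepow_nat[OF assms] by auto
  moreover have "inj_on (\<lambda>i. p ^ i) {..k}"
    using prime_gt_1_nat[OF assms] by (auto intro!: inj_onI)
  ultimately have "divisor_sum (p ^ k) = (\<Sum>i\<le>k. p ^ i)"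
    by (simp add: divisor_sum_def sum.reindex)
  thus ?thesis using power_diff_1_eq[of "real p" "Suc k"]
    by (simp add: lessThan_Suc_atMost mult.commute)
qed

lemma moebius_mu_prime_power:
  assumes "prime p"
  shows "moebius_mu (p ^ k) = (if k = 0 then 1 else if k = 1 then -1 else 0)"
proof -
  consider "k = 0" | "k = 1" | "k \<ge> 2" by linarith
  thus ?thesis
  proof cases
    case 3
    hence "\<not> squarefree (p ^ k)"
      using prime_gt_1_nat[OF assms] by (simp add: squarefree_power_iff)
    thus ?thesis using 3 by (simp only: moebius_mu_def if_False) simp
  qed (use assms in \<open>simp_all add: moebius_mu_def squarefree_prime prime_factorization_prime\<close>)
qed

lemma sigma_kappa_1 [simp]: "sigma_kappa \<kappa> (Suc 0) = 1"
  by (simp add: sigma_kappa_def moebius_mu_def divisor_sum_def)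

text \<open>The Moebius function vanishes at \<open>p ^ m\<close> for \<open>m \<ge> 2\<close>, so
  only the two largest divisors contribute.\<close>

lemma sigma_kappa_prime_power_Suc:
  assumes "prime p"
  shows "sigma_kappa \<kappa> (p ^ Suc k) =
           real (divisor_sum (p ^ Suc k)) powr \<kappa> - real (divisor_sum (p ^ k)) powr \<kappa>"
proof -
  have "{d. d dvd p ^ Suc k} = (\<lambda>i. p ^ i) ` {..Suc k}"
    using divides_primepow_nat[OF assms] by blast
  moreover have "inj_on (\<lambda>i. p ^ i) {..Suc k}"
    using prime_gt_1_nat[OF assms] by (auto intro!: inj_onI)
  ultimately have "sigma_kappa \<kappa> (p ^ Suc k) =
      (\<Sum>i\<le>Suc k. of_int (moebius_mu (p ^ Suc k div p ^ i)) * real (divisor_sum (p ^ i)) powr \<kappa>)"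
    unfolding sigma_kappa_def by (simp only: sum.reindex o_def)
  also have "\<dots> = (\<Sum>i\<le>Suc k. of_int (moebius_mu (p ^ (Suc k - i))) * real (divisor_sum (p ^ i)) powr \<kappa>)"
    using prime_gt_0_nat[OF assms] by (intro sum.cong refl) (simp add: power_diff del: power_Suc)
  also have "\<dots> = (\<Sum>i\<in>{k, Suc k}. of_int (moebius_mu (p ^ (Suc k - i))) * real (divisor_sum (p ^ i)) powr \<kappa>)"
    by (rule sum.mono_neutral_right) (auto simp: moebius_mu_prime_power[OF assms])
  finally show ?thesis using moebius_mu_prime_power[OF assms, of 1] moebius_mu_prime_power[OF assms, of 0]
    by simp
qed

text \<open>Clearing the denominator of the geometric sum gives one formula for all
  \<open>k\<close>; at \<open>k = 0\<close> the subtracted power is that of 0.\<close>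

lemma sigma_kappa_prime_power:
  assumes "prime p" "\<kappa> > 0"
  shows "sigma_kappa \<kappa> (p ^ k) * (real p - 1) powr \<kappa> =
           (real p ^ Suc k - 1) powr \<kappa> - (real p ^ k - 1) powr \<kappa>"
proof -
  have p: "real p - 1 \<ge> 0" using prime_gt_1_nat[OF assms(1)] by simp
  have D: "real (divisor_sum (p ^ i)) powr \<kappa> * (real p - 1) powr \<kappa> = (real p ^ Suc i - 1) powr \<kappa>" for i
    using p by (simp add: divisor_sum_prime_power[OF assms(1)] flip: powr_mult)
  show ?thesis
  proof (cases k)
    case (Suc i)
    show ?thesis unfolding Suc sigma_kappa_prime_power_Suc[OF assms(1)] left_diff_distrib D ..
  qed (use assms in simp)
qed

text \<open>This is the reason for the shape of \<open>F_kappa\<close>: by \<open>shift\<close>, its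
  denominator is \<open>x powr \<kappa>\<close> times its numerator with the exponent lowered by
  one. Up to the common factor \<open>(p - 1) powr \<kappa>\<close>, the logarithm is thus taken of
  the quotient of consecutive values of \<open>sigma_kappa\<close>, divided by
  \<open>p powr \<kappa>\<close>.\<close>

lemma sigma_kappa_prime_power_step:
  assumes \<kappa>: "\<kappa> > 1" and p: "prime p"
  shows "sigma_kappa \<kappa> (p ^ Suc k) =
           real p powr (\<kappa> * (1 + F_kappa \<kappa> (real p) (real (Suc k)))) * sigma_kappa \<kappa> (p ^ k)"
proof -
  define x where "x = real p"
  have x: "x > 1" using prime_gt_1_nat[OF p] by (simp add: x_def)
  define A B where "A = (x ^ Suc (Suc k) - 1) powr \<kappa> - (x ^ Suc k - 1) powr \<kappa>"
    and "B = (x ^ Suc k - 1) powr \<kappa> - (x ^ k - 1) powr \<kappa>"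
  have pos: "(x ^ Suc n - 1) powr \<kappa> - (x ^ n - 1) powr \<kappa> > 0" for n
  proof -
    have "(x ^ n - 1) powr \<kappa> < (x ^ Suc n - 1) powr \<kappa>"
      using x \<kappa> by (intro powr_less_mono2) auto
    thus ?thesis by simp
  qed
  have AB: "A > 0" "B > 0" using pos by (simp_all only: A_def B_def)
  have shift: "(x ^ Suc n - x) powr \<kappa> = x powr \<kappa> * (x ^ n - 1) powr \<kappa>" for n
    using x by (simp add: algebra_simps flip: powr_mult)
  have pw: "x powr real n = x ^ n" for n using x by (simp add: powr_realpow)
  have "F_kappa \<kappa> x (real (Suc k)) = 1 / (\<kappa> * ln x) * ln (A / (x powr \<kappa> * B))"
    using pw[of "Suc k"] pw[of "Suc (Suc k)"]
    by (simp add: F_kappa_def A_def B_def shift[of "Suc k", simplified] shift[of k, simplified]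
          right_diff_distrib add.commute)
  hence "\<kappa> * F_kappa \<kappa> x (real (Suc k)) * ln x = ln (A / (x powr \<kappa> * B))"
    using x \<kappa> by simp
  hence "x powr (\<kappa> * F_kappa \<kappa> x (real (Suc k))) = A / (x powr \<kappa> * B)"
    using x AB by (simp add: powr_def)
  hence "x powr (\<kappa> * (1 + F_kappa \<kappa> x (real (Suc k)))) * B = A"
    using x AB by (simp add: distrib_left powr_add)
  moreover have "sigma_kappa \<kappa> (p ^ Suc k) * (x - 1) powr \<kappa> = A"
      "sigma_kappa \<kappa> (p ^ k) * (x - 1) powr \<kappa> = B"
    using sigma_kappa_prime_power[OF p, of \<kappa> "Suc k"] sigma_kappa_prime_power[OF p, of \<kappa> k] \<kappa>
    by (simp_all only: A_def B_def x_def)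
  ultimately have "sigma_kappa \<kappa> (p ^ Suc k) * (x - 1) powr \<kappa> =
      x powr (\<kappa> * (1 + F_kappa \<kappa> x (real (Suc k)))) * sigma_kappa \<kappa> (p ^ k) * (x - 1) powr \<kappa>"
    by (simp only: mult.assoc)
  thus ?thesis using x unfolding x_def by simp
qed

lemma sigma_kappa_mult_prime:
  assumes \<kappa>: "\<kappa> > 1" and p: "prime p" and n: "n > 0"
  shows "sigma_kappa \<kappa> (n * p) =
           real p powr (\<kappa> * (1 + F_kappa \<kappa> (real p) (real (Suc (multiplicity p n))))) * sigma_kappa \<kappa> n"
proof -
  obtain m where m: "n = p ^ multiplicity p n * m" "\<not> p dvd m"
    using multiplicity_decompose'[of n p] p n by (metis not_prime_unit not_gr_zero)
  define k where "k = multiplicity p n"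
  have co: "coprime (p ^ i) m" for i
    using prime_imp_coprime[OF p m(2)] by simp
  have mp: "m > 0" "p ^ i > 0" for i using m n prime_gt_0_nat[OF p] by (auto intro: Nat.gr0I)
  have nk: "n = p ^ k * m" "n * p = p ^ Suc k * m" using m(1) unfolding k_def by (metis, simp add: ac_simps)
  show ?thesis unfolding k_def[symmetric] nk(2)
    unfolding nk(1) sigma_kappa_mult_coprime[OF co mp(2,1)] sigma_kappa_prime_power_step[OF \<kappa> p] by simp
qed

section \<open>Colossally abundant numbers\<close>

definition CA_ratio :: "real \<Rightarrow> real \<Rightarrow> nat \<Rightarrow> real" where
  "CA_ratio \<kappa> \<epsilon> n = sigma_kappa \<kappa> n / real n powr (\<kappa> * (1 + \<epsilon>))"

text \<open>The sign of \<open>F_kappa - \<epsilon>\<close> at the new exponent decides whether one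
  more factor \<open>p\<close> raises or lowers the ratio.\<close>

lemma CA_ratio_mult_prime:
  assumes "\<kappa> > 1" "prime p" "n > 0"
  shows "CA_ratio \<kappa> \<epsilon> (n * p) =
           real p powr (\<kappa> * (F_kappa \<kappa> (real p) (real (Suc (multiplicity p n))) - \<epsilon>)) * CA_ratio \<kappa> \<epsilon> n"
proof -
  have "\<kappa> * (F - \<epsilon>) = \<kappa> * (1 + F) - \<kappa> * (1 + \<epsilon>)" for F by (simp add: algebra_simps)
  thus ?thesis
    unfolding CA_ratio_def sigma_kappa_mult_prime[OF assms]
    by (simp only: powr_diff powr_mult of_nat_mult) simp
qed

text \<open>Not visible from the alternating sum, but building \<open>n\<close> up from 1 prime by
  prime multiplies the ratio by a positive factor each time.\<close>

lemma CA_ratio_pos: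
  assumes "\<kappa> > 1"
  shows "n > 0 \<Longrightarrow> CA_ratio \<kappa> \<epsilon> n > 0"
proof (induction n rule: prime_divisors_induct)
  case (factor p n)
  thus ?case using CA_ratio_mult_prime[OF assms, of p n \<epsilon>] prime_gt_0_nat[of p]
    by (simp add: mult.commute)
qed (auto simp: CA_ratio_def)

text \<open>The primes of \<open>k\<close> are multiplied in one at a time. Each raises one
  multiplicity to some \<open>j\<close> in the range of the hypothesis, so each contributes a factor
  at least 1.\<close>

lemma CA_ratio_le_mult:
  assumes "\<kappa> > 1" "n > 0" "k > 0"
    and "\<And>p j. prime p \<Longrightarrow> multiplicity p n < j \<Longrightarrow> j \<le> multiplicity p (n * k) \<Longrightarrow>
           F_kappa \<kappa> (real p) (real j) \<ge> \<epsilon>"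
  shows "CA_ratio \<kappa> \<epsilon> n \<le> CA_ratio \<kappa> \<epsilon> (n * k)"
  using assms(3,4)
proof (induction k rule: prime_divisors_induct)
  case (factor p k)
  let ?j = "Suc (multiplicity p (n * k))"
  from factor.prems(1) have k: "k > 0" by auto
  have p: "real p \<ge> 1" using prime_gt_0_nat[OF factor.hyps(1)] by simp
  have sub: "multiplicity q (n * k) \<le> multiplicity q (n * (p * k))" for q
    by (rule dvd_imp_multiplicity_le) (use factor.prems(1) assms(2) in auto)
  have "CA_ratio \<kappa> \<epsilon> n \<le> CA_ratio \<kappa> \<epsilon> (n * k)"
    using factor.prems(2) sub k by (intro factor.IH) (auto intro: le_trans)
  also have "\<dots> \<le> real p powr (\<kappa> * (F_kappa \<kappa> (real p) (real ?j) - \<epsilon>)) * CA_ratio \<kappa> \<epsilon> (n * k)"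
  proof -
    have "multiplicity p n \<le> multiplicity p (n * k)"
      by (rule dvd_imp_multiplicity_le) (use k assms(2) in auto)
    moreover have "multiplicity p (n * (p * k)) = ?j"
      using factor.hyps(1) k assms(2)
      by (simp add: prime_elem_multiplicity_mult_distrib)
    ultimately have "F_kappa \<kappa> (real p) (real ?j) \<ge> \<epsilon>"
      by (intro factor.prems(2)[OF factor.hyps(1)]) auto
    hence "real p powr (\<kappa> * (F_kappa \<kappa> (real p) (real ?j) - \<epsilon>)) \<ge> 1"
      using p assms(1) by (intro ge_one_powr_ge_zero) auto
    thus ?thesis using CA_ratio_pos[OF assms(1), of "n * k" \<epsilon>] k assms(2) by simp
  qed
  also have "\<dots> = CA_ratio \<kappa> \<epsilon> (n * (p * k))"
    using CA_ratio_mult_prime[OF assms(1) factor.hyps(1), of "n * k" \<epsilon>] k assms(2)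
    by (simp add: ac_simps)
  finally show ?case .
qed auto

lemma CA_ratio_mult_le:
  assumes "\<kappa> > 1" "n > 0" "k > 0"
    and "\<And>p j. prime p \<Longrightarrow> multiplicity p n < j \<Longrightarrow> j \<le> multiplicity p (n * k) \<Longrightarrow>
           F_kappa \<kappa> (real p) (real j) \<le> \<epsilon>"
  shows "CA_ratio \<kappa> \<epsilon> (n * k) \<le> CA_ratio \<kappa> \<epsilon> n"
  using assms(3,4)
proof (induction k rule: prime_divisors_induct)
  case (factor p k)
  let ?j = "Suc (multiplicity p (n * k))"
  from factor.prems(1) have k: "k > 0" by auto
  have p: "real p \<ge> 1" using prime_gt_0_nat[OF factor.hyps(1)] by simp
  have sub: "multiplicity q (n * k) \<le> multiplicity q (n * (p * k))" for q
    by (rule dvd_imp_multiplicity_le) (use factor.prems(1) assms(2) in auto)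
  have "CA_ratio \<kappa> \<epsilon> (n * (p * k)) =
      real p powr (\<kappa> * (F_kappa \<kappa> (real p) (real ?j) - \<epsilon>)) * CA_ratio \<kappa> \<epsilon> (n * k)"
    using CA_ratio_mult_prime[OF assms(1) factor.hyps(1), of "n * k" \<epsilon>] k assms(2)
    by (simp add: ac_simps)
  also have "\<dots> \<le> CA_ratio \<kappa> \<epsilon> (n * k)"
  proof -
    have "multiplicity p n \<le> multiplicity p (n * k)"
      by (rule dvd_imp_multiplicity_le) (use k assms(2) in auto)
    moreover have "multiplicity p (n * (p * k)) = ?j"
      using factor.hyps(1) k assms(2)
      by (simp add: prime_elem_multiplicity_mult_distrib)
    ultimately have "F_kappa \<kappa> (real p) (real ?j) \<le> \<epsilon>"
      by (intro factor.prems(2)[OF factor.hyps(1)]) auto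
    hence "real p powr (\<kappa> * (F_kappa \<kappa> (real p) (real ?j) - \<epsilon>)) \<le> real p powr 0"
      using p assms(1) by (intro powr_mono) (auto simp: mult_le_0_iff)
    thus ?thesis using CA_ratio_pos[OF assms(1), of "n * k" \<epsilon>] k assms(2) p by simp
  qed
  also have "\<dots> \<le> CA_ratio \<kappa> \<epsilon> n"
    using factor.prems(2) sub k by (intro factor.IH) (auto intro: le_trans)
  finally show ?case .
qed auto

text \<open>The competitor \<open>n\<close> is compared with \<open>N\<close> through their lcm:
  passing from \<open>n\<close> to the lcm adds only prime factors present in \<open>N\<close>, and
  passing from the lcm to \<open>N\<close> removes only factors in excess of \<open>N\<close>. Ties
  \<open>F_kappa = \<epsilon>\<close> are left free, which lets the same criterion serve at either
  end of a tie.\<close>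

lemma colossally_abundantI:
  assumes "\<kappa> > 1" "N > 0"
    and gt: "\<And>p j. prime p \<Longrightarrow> j > 0 \<Longrightarrow> F_kappa \<kappa> (real p) (real j) > \<epsilon> \<Longrightarrow> j \<le> multiplicity p N"
    and le: "\<And>p j. prime p \<Longrightarrow> j > 0 \<Longrightarrow> j \<le> multiplicity p N \<Longrightarrow> F_kappa \<kappa> (real p) (real j) \<ge> \<epsilon>"
  shows "colossally_abundant \<kappa> \<epsilon> N"
proof -
  have "CA_ratio \<kappa> \<epsilon> n \<le> CA_ratio \<kappa> \<epsilon> N" if n: "n > 0" for n
  proof -
    obtain k where k: "lcm n N = n * k" using dvd_lcm1[of n N] unfolding dvd_def by blast
    obtain l where l: "lcm n N = N * l" using dvd_lcm2[of N n] unfolding dvd_def by blast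
    have pos: "lcm n N > 0" using n assms(2) by (simp add: lcm_pos_nat)
    have mult: "multiplicity p (lcm n N) = max (multiplicity p n) (multiplicity p N)"
      if "prime p" for p
      using that n assms(2) by (intro multiplicity_lcm) auto
    have "CA_ratio \<kappa> \<epsilon> n \<le> CA_ratio \<kappa> \<epsilon> (lcm n N)"
      unfolding k
    proof (rule CA_ratio_le_mult[OF assms(1) n])
      show "k > 0" using k pos by (auto intro: Nat.gr0I)
      show "F_kappa \<kappa> (real p) (real j) \<ge> \<epsilon>"
        if "prime p" "multiplicity p n < j" "j \<le> multiplicity p (n * k)" for p j
        using that mult[OF that(1)] unfolding k by (intro le) auto
    qed
    also have "CA_ratio \<kappa> \<epsilon> (lcm n N) \<le> CA_ratio \<kappa> \<epsilon> N"
      unfolding l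
    proof (rule CA_ratio_mult_le[OF assms(1,2)])
      show "l > 0" using l pos by (auto intro: Nat.gr0I)
      show "F_kappa \<kappa> (real p) (real j) \<le> \<epsilon>" if "prime p" "multiplicity p N < j" for p j
        using gt[of p j] that by force
    qed
    finally show ?thesis .
  qed
  thus ?thesis using assms(2) by (simp add: colossally_abundant_def CA_ratio_def)
qed

lemma colossally_abundant_multiplicity:
  assumes "\<kappa> > 1" and CA: "colossally_abundant \<kappa> \<epsilon> N" and p: "prime p" and j: "multiplicity p N \<ge> j" "j > 0"
  shows "F_kappa \<kappa> (real p) (real j) \<ge> \<epsilon>"
proof (rule ccontr)
  assume less: "\<not> ?thesis"
  define k where "k = multiplicity p N"
  have x: "real p > 1" using prime_gt_1_nat[OF p] by simp
  have N: "N > 0" using CA by (simp add: colossally_abundant_def)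
  \<comment> \<open>Monotonicity moves the failure at \<open>j\<close> to the top exponent
    \<open>k\<close>, the one removed on dividing \<open>N\<close> by \<open>p\<close>; that
    division then increases the ratio.\<close>
  have "F_kappa \<kappa> (real p) (real k) \<le> F_kappa \<kappa> (real p) (real j)"
    using F_kappa_strict_antimono[OF assms(1) x, of "real j" "real k"] j
    by (cases "k = j") (auto simp: k_def)
  hence Fk: "F_kappa \<kappa> (real p) (real k) < \<epsilon>" using less by simp
  have "p dvd N" using j by (auto simp: not_dvd_imp_multiplicity_0 intro: ccontr)
  then obtain n where n: "N = n * p" by (metis dvdE mult.commute)
  have "n > 0" using n N by (auto intro: Nat.gr0I)
  have "Suc (multiplicity p n) = k"
    using \<open>n > 0\<close> p by (simp add: k_def n prime_elem_multiplicity_mult_distrib)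
  hence "CA_ratio \<kappa> \<epsilon> N = real p powr (\<kappa> * (F_kappa \<kappa> (real p) (real k) - \<epsilon>)) * CA_ratio \<kappa> \<epsilon> n"
    using CA_ratio_mult_prime[OF assms(1) p \<open>n > 0\<close>] n by simp
  also have "\<dots> < CA_ratio \<kappa> \<epsilon> n"
  proof -
    have "real p powr (\<kappa> * (F_kappa \<kappa> (real p) (real k) - \<epsilon>)) < real p powr 0"
      using x assms(1) Fk by (intro powr_less_mono) (auto simp: mult_less_0_iff)
    thus ?thesis using CA_ratio_pos[OF assms(1) \<open>n > 0\<close>, of \<epsilon>] x by simp
  qed
  finally show False using CA \<open>n > 0\<close> by (auto simp: colossally_abundant_def CA_ratio_def not_less[symmetric])
qed

section \<open>The largest colossally abundant number as a product\<close>

lemma multiplicity_prod_fst: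
  fixes S :: "(nat \<times> 'a) set"
  assumes "finite S" "\<And>p j. (p, j) \<in> S \<Longrightarrow> prime p" "prime q"
  shows "multiplicity q (\<Prod>(p, j)\<in>S. p) = card {j. (q, j) \<in> S}"
proof -
  have "multiplicity q (\<Prod>s\<in>S. fst s) = (\<Sum>s\<in>S. multiplicity q (fst s))"
    using assms by (intro prime_elem_multiplicity_prod_distrib) (auto, use not_prime_0 in blast)
  also have "\<dots> = (\<Sum>s\<in>S. if fst s = q then 1 else 0)"
    using assms by (intro sum.cong) (auto simp: prime_multiplicity_other)
  also have "\<dots> = card {s\<in>S. fst s = q}"
    using assms(1) by (simp add: sum.If_cases Int_def)
  also have "{s\<in>S. fst s = q} = Pair q ` {j. (q, j) \<in> S}" by force
  also have "card \<dots> = card {j. (q, j) \<in> S}" by (intro card_image) (auto intro: inj_onI)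
  finally show ?thesis by (simp add: case_prod_unfold)
qed

text \<open>Such a \<open>D\<close> is an initial segment of the positive integers. This turns a
  multiplicity, computed as a cardinality, back into membership.\<close>

lemma le_card_down_closed_iff:
  fixes D :: "nat set"
  assumes "finite D" "D \<subseteq> {0<..}" "\<And>i j. j \<in> D \<Longrightarrow> 0 < i \<Longrightarrow> i \<le> j \<Longrightarrow> i \<in> D" "j > 0"
  shows "j \<le> card D \<longleftrightarrow> j \<in> D"
proof
  assume "j \<in> D"
  hence "{1..j} \<subseteq> D" using assms(3) by auto
  thus "j \<le> card D" using card_mono[OF assms(1), of "{1..j}"] by simp
next
  assume j: "j \<le> card D"
  show "j \<in> D"
  proof (rule ccontr)
    assume "j \<notin> D"
    hence "i < j" if "i \<in> D" for i using assms(3)[OF that assms(4)] by (meson not_less)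
    hence "D \<subseteq> {1..<j}" using assms(2) by force
    hence "card D \<le> j - 1" using card_mono[of "{1..<j}" D] by simp
    thus False using j assms(4) by simp
  qed
qed

text \<open>Pairs rather than values are collected, so that a value attained by several pairs
  contributes a prime for each of them.\<close>

definition critical_pairs :: "real \<Rightarrow> real \<Rightarrow> (nat \<times> nat) set" where
  "critical_pairs \<kappa> \<epsilon> = {(p, j). prime p \<and> j > 0 \<and> F_kappa \<kappa> (real p) (real j) \<ge> \<epsilon>}"

lemma F_kappa_pos_nat: "\<kappa> > 1 \<Longrightarrow> prime p \<Longrightarrow> j > 0 \<Longrightarrow> F_kappa \<kappa> (real p) (real j) > 0"
  using prime_gt_1_nat[of p] by (intro F_kappa_pos) auto

lemma F_kappa_antimono_nat:
  assumes "\<kappa> > 1" "prime p" "0 < i" "i < j"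
  shows "F_kappa \<kappa> (real p) (real j) < F_kappa \<kappa> (real p) (real i)"
  using assms prime_gt_1_nat[of p] by (intro F_kappa_strict_antimono) auto

lemma le_multiplicity_prod_critical_pairs:
  assumes \<kappa>: "\<kappa> > 1" and \<epsilon>: "\<epsilon> > 0" and p: "prime p" and j: "j > 0"
  shows "j \<le> multiplicity p (\<Prod>(q, i)\<in>critical_pairs \<kappa> \<epsilon>. q) \<longleftrightarrow> F_kappa \<kappa> (real p) (real j) \<ge> \<epsilon>"
proof -
  let ?D = "{j. (p, j) \<in> critical_pairs \<kappa> \<epsilon>}"
  have fin: "finite (critical_pairs \<kappa> \<epsilon>)"
    using finite_F_kappa_ge[OF \<kappa> \<epsilon>] by (simp add: critical_pairs_def)
  have "?D \<subseteq> snd ` critical_pairs \<kappa> \<epsilon>" by force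
  hence "finite ?D" using fin finite_surj by blast
  moreover have "i \<in> ?D" if "j \<in> ?D" "0 < i" "i \<le> j" for i j
    using F_kappa_antimono_nat[OF \<kappa> p, of i j] that
    by (cases "i = j") (auto simp: critical_pairs_def)
  ultimately have "j \<le> card ?D \<longleftrightarrow> j \<in> ?D"
    using j by (intro le_card_down_closed_iff) (auto simp: critical_pairs_def)
  moreover have "multiplicity p (\<Prod>(q, i)\<in>critical_pairs \<kappa> \<epsilon>. q) = card ?D"
    using fin p by (intro multiplicity_prod_fst) (auto simp: critical_pairs_def)
  ultimately show ?thesis using p j by (simp add: critical_pairs_def)
qed

lemma prod_critical_pairs_pos: "(\<Prod>(q, i)\<in>critical_pairs \<kappa> \<epsilon>. q) > 0"
  by (intro prod_pos) (auto simp: critical_pairs_def prime_gt_0_nat)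

text \<open>Any colossally abundant \<open>N\<close> has only exponents with
  \<open>F_kappa \<ge> \<epsilon>\<close>, so it divides the product: the product is largest even
  with respect to divisibility.\<close>

lemma
  assumes \<kappa>: "\<kappa> > 1" and \<epsilon>: "\<epsilon> > 0"
  shows largest_CA_eq_prod: "largest_CA \<kappa> \<epsilon> = (\<Prod>(p, j)\<in>critical_pairs \<kappa> \<epsilon>. p)"
    and colossally_abundant_largest_CA: "colossally_abundant \<kappa> \<epsilon> (largest_CA \<kappa> \<epsilon>)"
    and colossally_abundant_le_largest_CA: "colossally_abundant \<kappa> \<epsilon> N \<Longrightarrow> N \<le> largest_CA \<kappa> \<epsilon>"
proof -
  let ?L = "\<Prod>(p, j)\<in>critical_pairs \<kappa> \<epsilon>. p"
  note mult = le_multiplicity_prod_critical_pairs[OF \<kappa> \<epsilon>]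
  have CA: "colossally_abundant \<kappa> \<epsilon> ?L"
    using prod_critical_pairs_pos by (intro colossally_abundantI \<kappa>) (auto simp: mult)
  have le: "N \<le> ?L" if N: "colossally_abundant \<kappa> \<epsilon> N" for N
  proof -
    have "multiplicity p N \<le> multiplicity p ?L" if "prime p" for p
      using mult[OF that, of "multiplicity p N"]
        colossally_abundant_multiplicity[OF \<kappa> N that, of "multiplicity p N"]
      by (cases "multiplicity p N = 0") auto
    hence "N dvd ?L"
      using N by (intro multiplicity_le_imp_dvd) (auto simp: colossally_abundant_def)
    thus ?thesis using prod_critical_pairs_pos by (rule dvd_imp_le)
  qed
  show L: "largest_CA \<kappa> \<epsilon> = ?L"
    unfolding largest_CA_def by (intro Greatest_equality CA le)
  show "colossally_abundant \<kappa> \<epsilon> (largest_CA \<kappa> \<epsilon>)"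
    "colossally_abundant \<kappa> \<epsilon> N \<Longrightarrow> N \<le> largest_CA \<kappa> \<epsilon>"
    unfolding L using CA le by blast+
qed

section \<open>Enumerating the critical values\<close>

text \<open>Ranking each element by the number of elements above it gives an injection into the
  naturals. Its image is unbounded and closed under predecessors, so it is a bijection, and
  \<open>e\<close> is its inverse.\<close>

lemma decreasing_enumeration:
  fixes C :: "'a :: linorder set"
  assumes inf: "infinite C" and fin: "\<And>v. v \<in> C \<Longrightarrow> finite {w\<in>C. w > v}"
  obtains e :: "nat \<Rightarrow> 'a" where "range e = C" "\<And>i. e (Suc i) < e i"
proof -
  define r where "r = (\<lambda>v. card {w\<in>C. w > v})"
  have r_less: "r w < r v" if "v \<in> C" "w \<in> C" "v < w" for v w
    unfolding r_def using that by (intro psubset_card_mono fin) auto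
  have inj: "inj_on r C"
    by (rule inj_onI) (metis r_less less_irrefl linorder_neqE)
  have pred: "n \<in> r ` C" if "Suc n \<in> r ` C" for n
  proof -
    obtain v where v: "v \<in> C" "r v = Suc n" using \<open>Suc n \<in> r ` C\<close> by force
    let ?A = "{w\<in>C. w > v}"
    have A: "finite ?A" "card ?A = Suc n" using fin[OF v(1)] v(2) by (auto simp: r_def)
    hence ne: "?A \<noteq> {}" by (metis card.empty nat.distinct(1))
    \<comment> \<open>The immediate neighbour of \<open>v\<close> from above: exactly the element
      \<open>w\<close> itself is lost from the set being counted.\<close>
    define w where "w = Min ?A"
    have w: "w \<in> ?A" using Min_in[OF A(1) ne] by (simp add: w_def)
    have "{u\<in>C. u > w} = ?A - {w}"
      using w Min_le[OF A(1)] by (force simp: w_def[symmetric])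
    hence "r w = n" using w A(1) v(2) by (simp add: r_def)
    thus ?thesis using w by blast
  qed
  have surj: "r ` C = UNIV"
  proof -
    have "n \<in> r ` C" for n
    proof -
      obtain m where "n \<le> m" "m \<in> r ` C"
        using inf finite_imageD[OF _ inj] by (metis infinite_nat_iff_unbounded_le)
      thus ?thesis by (induction rule: inc_induct) (use pred in auto)
    qed
    thus ?thesis by blast
  qed
  define e where "e = inv_into C r"
  have re: "r (e i) = i" and eC: "e i \<in> C" for i
    using surj by (auto simp: e_def f_inv_into_f inv_into_into)
  show ?thesis
  proof
    show "range e = C"
      using inv_into_image_cancel[OF inj order_refl] surj by (simp add: e_def)
    show "e (Suc i) < e i" for i
      using r_less[OF eC eC, of i "Suc i"] re by (metis Suc_n_not_le_n less_or_eq_imp_le linorder_neqE n_not_Suc_n)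
  qed
qed

lemma finite_critical_set_ge:
  assumes "\<kappa> > 1" "r > 0"
  shows "finite {w\<in>critical_set \<kappa>. w \<ge> ereal r}"
proof (rule finite_subset)
  show "{w\<in>critical_set \<kappa>. w \<ge> ereal r} \<subseteq>
      insert \<infinity> ((\<lambda>(p, j). ereal (F_kappa \<kappa> (real p) (real j))) ` critical_pairs \<kappa> r)"
    by (auto simp: critical_set_def critical_pairs_def)
  show "finite \<dots>"
    using finite_F_kappa_ge[OF assms] by (simp add: critical_pairs_def)
qed

lemma critical_set_pos: "\<kappa> > 1 \<Longrightarrow> v \<in> critical_set \<kappa> \<Longrightarrow> v > 0"
  using F_kappa_pos_nat by (auto simp: critical_set_def)

text \<open>The prime 2 suffices, since its critical values are strictly decreasing in the
  exponent.\<close>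

lemma infinite_critical_set:
  assumes "\<kappa> > 1"
  shows "infinite (critical_set \<kappa>)"
proof
  assume "finite (critical_set \<kappa>)"
  moreover have "range (\<lambda>j. ereal (F_kappa \<kappa> (real 2) (real (Suc j)))) \<subseteq> critical_set \<kappa>"
    unfolding critical_set_def using two_is_prime_nat by blast
  moreover have "inj (\<lambda>j. ereal (F_kappa \<kappa> (real 2) (real (Suc j))))"
  proof (rule injI)
    fix i j assume "ereal (F_kappa \<kappa> (real 2) (real (Suc i))) = ereal (F_kappa \<kappa> (real 2) (real (Suc j)))"
    thus "i = j"
      using F_kappa_antimono_nat[OF assms two_is_prime_nat, of "Suc i" "Suc j"]
        F_kappa_antimono_nat[OF assms two_is_prime_nat, of "Suc j" "Suc i"]
      by (cases i j rule: linorder_cases) auto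
  qed
  ultimately show False using finite_subset range_inj_infinite by blast
qed

lemma ex_critical_enumeration:
  assumes \<kappa>: "\<kappa> > 1"
  shows "\<exists>e. critical_enumeration \<kappa> e"
proof -
  have "finite {w\<in>critical_set \<kappa>. w > v}" if v: "v \<in> critical_set \<kappa>" for v
  proof (cases v)
    case (real r)
    hence "r > 0" using critical_set_pos[OF \<kappa> v] by simp
    show ?thesis
      by (rule finite_subset[OF _ finite_critical_set_ge[OF \<kappa> \<open>r > 0\<close>]]) (auto simp: real)
  qed (use critical_set_pos[OF \<kappa> v] in auto)
  then obtain e where e: "range e = critical_set \<kappa>" "\<And>i. e (Suc i) < e i"
    using decreasing_enumeration[OF infinite_critical_set[OF \<kappa>]] by metis
  have less: "e j < e i" if "i < j" for i j
    using that by (induction rule: less_Suc_induct) (auto intro: e(2) less_trans)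
  have pos: "e i > 0" for i using critical_set_pos[OF \<kappa>, of "e i"] e(1) by blast
  obtain k where k: "e k = \<infinity>" 
  proof -
    have "\<infinity> \<in> range e" unfolding e(1) critical_set_def by simp
    thus ?thesis using that by (metis imageE)
  qed
  have e0: "e 0 = \<infinity>" using less[of 0 k] k by (cases "k = 0") auto
  have "e \<longlonglongrightarrow> 0"
  proof (rule order_tendstoI)
    fix a :: ereal assume "a > 0"
    then obtain r where r: "0 < ereal r" "ereal r < a" using ereal_dense2 by blast
    \<comment> \<open>Otherwise the whole infinite critical set would lie above the positive real
      \<open>r\<close>, where only finitely many values lie.\<close>
    have "\<exists>i. e i < a"
    proof (rule ccontr)
      assume "\<nexists>i. e i < a"
      hence "ereal r \<le> e n" for n using r(2) by (meson less_imp_le less_le_trans not_less)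
      hence "critical_set \<kappa> \<subseteq> {w\<in>critical_set \<kappa>. w \<ge> ereal r}"
        unfolding e(1)[symmetric] by auto
      thus False
        using infinite_critical_set[OF \<kappa>] finite_critical_set_ge[OF \<kappa>, of r] r finite_subset by auto
    qed
    then obtain i where "e i < a" by blast
    hence "e n < a" if "n \<ge> i" for n using less[of i n] that by (cases "n = i") auto
    thus "\<forall>\<^sub>F n in sequentially. e n < a" by (auto simp: eventually_sequentially)
  qed (use pos in \<open>auto intro: always_eventually less_trans\<close>)
  thus ?thesis using e e0 pos by (auto simp: critical_enumeration_def)
qed

lemma critical_enumeration_less:
  assumes "critical_enumeration \<kappa> e" "i < j"
  shows "e j < e i"
  using assms(2,1)
  by (induction rule: less_Suc_induct) (auto simp: critical_enumeration_def intro: less_trans)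

lemma critical_enumeration_eq_F:
  assumes "critical_enumeration \<kappa> e" "i \<ge> 1"
  obtains p j where "prime p" "j > 0" "e i = ereal (F_kappa \<kappa> (real p) (real j))"
proof -
  have "e i \<noteq> \<infinity>" using critical_enumeration_less[OF assms(1), of 0 i] assms(2) by auto
  moreover have "e i \<in> critical_set \<kappa>" using assms(1) by (auto simp: critical_enumeration_def)
  ultimately show ?thesis using that by (auto simp: critical_set_def)
qed

text \<open>Every \<open>F_kappa\<close> value is some \<open>e k\<close>, and exceeding
  \<open>e i\<close> forces \<open>k < i\<close>; so none lies strictly between neighbours.\<close>

lemma critical_enumeration_gap:
  assumes e: "critical_enumeration \<kappa> e" and "i \<ge> 1" "prime p" "j > 0"
    and gt: "e i < ereal (F_kappa \<kappa> (real p) (real j))"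
  shows "e (i - 1) \<le> ereal (F_kappa \<kappa> (real p) (real j))"
proof -
  have "ereal (F_kappa \<kappa> (real p) (real j)) \<in> range e"
    using assms unfolding critical_enumeration_def critical_set_def by blast
  then obtain k where k: "ereal (F_kappa \<kappa> (real p) (real j)) = e k" by blast
  have "k < i" using critical_enumeration_less[OF e, of i k] gt k by (cases i k rule: linorder_cases) auto
  hence "k = i - 1 \<or> k < i - 1" by linarith
  thus ?thesis using critical_enumeration_less[OF e, of k "i - 1"] k by (auto intro: less_imp_le)
qed

text \<open>The right-hand side does not mention \<epsilon>, which yields constancy on the interval.
  Its upper endpoint belongs to it because pairs with \<open>F_kappa = \<epsilon>\<close> are
  counted, and its lower endpoint does not because pairs attaining \<open>e i\<close> are
  excluded.\<close>

lemma critical_pairs_eq: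
  assumes e: "critical_enumeration \<kappa> e" and i: "i \<ge> 1" and \<epsilon>: "\<epsilon> \<in> critical_interval e i"
  shows "critical_pairs \<kappa> \<epsilon> = {(p, j). prime p \<and> j > 0 \<and> e i < ereal (F_kappa \<kappa> (real p) (real j))}"
proof -
  have \<epsilon>: "e i < ereal \<epsilon>" "ereal \<epsilon> \<le> e (i - 1)" using \<epsilon> by (auto simp: critical_interval_def)
  have "\<epsilon> \<le> F_kappa \<kappa> (real p) (real j) \<longleftrightarrow> e i < ereal (F_kappa \<kappa> (real p) (real j))"
    if "prime p" "j > 0" for p j
    using critical_enumeration_gap[OF e i that] \<epsilon> 
    by (metis ereal_less_eq(3) less_le_trans order_trans)
  thus ?thesis by (auto simp: critical_pairs_def)
qed

section \<open>Constancy, strict growth, and abundance at the next critical value\<close>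

theorem theorem4p25:
  fixes \<kappa> :: real
  assumes "\<kappa> > 1"
  shows "(\<exists>e. critical_enumeration \<kappa> e) \<and>
    (\<forall>\<epsilon>>0. colossally_abundant \<kappa> \<epsilon> (largest_CA \<kappa> \<epsilon>) \<and>
            (\<forall>N. colossally_abundant \<kappa> \<epsilon> N \<longrightarrow> N \<le> largest_CA \<kappa> \<epsilon>)) \<and>
    (\<forall>e. critical_enumeration \<kappa> e \<longrightarrow>
       (\<exists>M :: nat \<Rightarrow> nat.
          (\<forall>i\<ge>1. \<forall>\<epsilon>\<in>critical_interval e i. largest_CA \<kappa> \<epsilon> = M i) \<and>
          strict_mono_on {1..} M) \<and>
       (\<forall>i\<ge>1. colossally_abundant \<kappa> (real_of_ereal (e (i + 1)))
                 (largest_CA \<kappa> (real_of_ereal (e i)))))"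
proof (intro conjI allI impI)
  show "\<exists>e. critical_enumeration \<kappa> e" by (rule ex_critical_enumeration[OF assms])
  show "colossally_abundant \<kappa> \<epsilon> (largest_CA \<kappa> \<epsilon>)" if "\<epsilon> > 0" for \<epsilon>
    by (rule colossally_abundant_largest_CA[OF assms that])
  show "N \<le> largest_CA \<kappa> \<epsilon>" if "\<epsilon> > 0" "colossally_abundant \<kappa> \<epsilon> N" for \<epsilon> N
    using that by (rule colossally_abundant_le_largest_CA[OF assms])
next
  fix e assume e: "critical_enumeration \<kappa> e"
  define P where "P = (\<lambda>i. {(p, j). prime p \<and> j > 0 \<and> e i < ereal (F_kappa \<kappa> (real p) (real j))})"
  define M where "M = (\<lambda>i. \<Prod>(p :: nat, j :: nat)\<in>P i. p)"
  have e_pos: "e i > 0" for i using e by (simp add: critical_enumeration_def)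
  have "largest_CA \<kappa> \<epsilon> = M i" if i: "i \<ge> 1" "\<epsilon> \<in> critical_interval e i" for i \<epsilon>
  proof -
    have "\<epsilon> > 0" using i(2) less_trans[OF e_pos[of i], of "ereal \<epsilon>"] by (simp add: critical_interval_def)
    thus ?thesis using critical_pairs_eq[OF e i] by (simp add: largest_CA_eq_prod[OF assms] M_def P_def)
  qed
  moreover have "strict_mono_on {1..} M"
  proof (rule strict_mono_onI)
    fix i k :: nat assume "i \<in> {1..}" "k \<in> {1..}" and ik: "i < k"
    hence i: "i \<ge> 1" and k: "k \<ge> 1" by auto
    obtain p j where pj: "prime p" "j > 0" "e i = ereal (F_kappa \<kappa> (real p) (real j))"
      using critical_enumeration_eq_F[OF e i] .
    obtain q l where ql: "prime q" "l > 0" "e k = ereal (F_kappa \<kappa> (real q) (real l))"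
      using critical_enumeration_eq_F[OF e k] .
    have "finite (critical_pairs \<kappa> (F_kappa \<kappa> (real q) (real l)))"
      using finite_F_kappa_ge[OF assms F_kappa_pos_nat[OF assms ql(1,2)]] by (simp add: critical_pairs_def)
    hence fin: "finite (P k)"
      by (rule finite_subset[rotated]) (auto simp: P_def critical_pairs_def ql(3))
    \<comment> \<open>The pair attaining \<open>e i\<close> lies in \<open>P k\<close> since
      \<open>e k < e i\<close>, but not in \<open>P i\<close> because of the strict inequality
      there. Hence \<open>p * M i\<close> divides \<open>M k\<close>.\<close>
    have sub: "insert (p, j) (P i) \<subseteq> P k"
      using critical_enumeration_less[OF e ik] pj by (auto simp: P_def intro: less_trans)
    have fini: "finite (P i)" using finite_subset[OF sub fin] by simp
    have M_pos: "M n > 0" for n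
      unfolding M_def P_def by (intro prod_pos) (auto intro: prime_gt_0_nat)
    have "M i < p * M i" using M_pos[of i] prime_gt_1_nat[OF pj(1)] by simp
    also have "\<dots> = (\<Prod>(p, j)\<in>insert (p, j) (P i). p)"
      using fini pj(3) by (simp add: M_def P_def)
    also have "\<dots> \<le> M k"
      using dvd_imp_le[OF prod_dvd_prod_subset[OF fin sub]] M_pos[of k] unfolding M_def by blast
    finally show "M i < M k" .
  qed
  ultimately show "\<exists>M. (\<forall>i\<ge>1. \<forall>\<epsilon>\<in>critical_interval e i. largest_CA \<kappa> \<epsilon> = M i) \<and> strict_mono_on {1..} M"
    by blast
  fix i :: nat assume i: "i \<ge> 1"
  obtain r where r: "e i = ereal r" using critical_enumeration_eq_F[OF e i] by metis
  obtain s where s: "e (Suc i) = ereal s" using critical_enumeration_eq_F[OF e, of "Suc i"] by auto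
  have rs: "r > 0" "s < r"
    using e_pos[of i] critical_enumeration_less[OF e, of i "Suc i"] by (auto simp: r s)
  note mult = le_multiplicity_prod_critical_pairs[OF assms rs(1)]
  have "colossally_abundant \<kappa> s (largest_CA \<kappa> r)"
    unfolding largest_CA_eq_prod[OF assms rs(1)]
  proof (intro colossally_abundantI assms prod_critical_pairs_pos)
    \<comment> \<open>A critical value above \<open>s = e (i + 1)\<close> is at least
      \<open>e i = r\<close> by the gap lemma, so its pair is already counted in the product for
      \<open>r\<close>.\<close>
    show "j \<le> multiplicity p (\<Prod>(q, i)\<in>critical_pairs \<kappa> r. q)"
      if "prime p" "j > 0" "s < F_kappa \<kappa> (real p) (real j)" for p j
      using critical_enumeration_gap[OF e, of "i + 1" p j] that by (simp add: mult r s)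
    show "s \<le> F_kappa \<kappa> (real p) (real j)"
      if "prime p" "j > 0" "j \<le> multiplicity p (\<Prod>(q, i)\<in>critical_pairs \<kappa> r. q)" for p j
      using that rs(2) by (simp add: mult)
  qed
  thus "colossally_abundant \<kappa> (real_of_ereal (e (i + 1))) (largest_CA \<kappa> (real_of_ereal (e i)))"
    by (simp add: r s)
qed

end
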